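(* (a) Let $G=\langle N,K,\mathbf w,v\rangle$ be a weighted competition game with $k$ symmetric firms (all having the same value function $v$). If there is an almost-balanced partition of the workers (with respect to $\mathbf w$), then $G$ admits a proportional PSPE. (b) Symmetry is a necessary condition: there is a weighted competition game whose firms do not all have the same value function, for which there is an almost-balanced partition of the workers, and which has no PSPE.
   Context: Competition game: $N$ is a finite set of workers, $K$ a finite set of $k\ge 2$ firms, and each firm $i\in K$ has a nondecreasing value function $v_i:2^N\to\mathbb R_+$ with $v_i(\emptyset)=0$. In step 1 all firms simultaneously choose payment policies $\mathbf x_i=(x_{ij})_{j\in N}\in\mathbb R^N$ (payments may be negative). In step 2 each worker chooses a firm or stays idle. An outcome is a pair $(P,\mathbf X)$ where $\mathbf X=(x_{ij})$ and $P=(S_0,(S_i)_{i\in K})$ is a partition of $N$ ($S_0$ = idle workers; parts may be empty). Put $x_{0j}=0$. A worker $j\in S_i$ receives $\hat x_j=x_{ij}$; firm $i$ has profit $r_i(P,\mathbf X)=v_i(S_i)-\sum_{j\in S_i}x_{ij}$. PSPE: let $\mathcal P(\mathbf X)$ be the set of partitions such that every worker $j\in S_i$ ($i\in K\cup\{0\}$) satisfies $x_{ij}=\max_{i'\in K\cup\{0\}}x_{i'j}$. A tie-breaking rule is a map $\mathbf X\mapsto P(\mathbf X)\in\mathcal P(\mathbf X)$. An outcome $(P,\mathbf X)$ is a pure subgame perfect equilibrium (PSPE) if for some tie-breaking rule: (a) $P=P(\mathbf X)$; and (b) for every $i\in K$ and every policy $\mathbf x_i'$, $r_i(P',\mathbf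 X')\le r_i(P,\mathbf X)$, where $\mathbf X'=(\mathbf x_{-i},\mathbf x_i')$ and $P'=P(\mathbf X')$. Weighted game: each worker $j$ has a positive integer weight $w_j$, and $v_i(S)=v_i\big(\sum_{j\in S}w_j\big)$ for a nondecreasing function $v_i:\mathbb N\to\mathbb R_+$ with $v_i(0)=0$ whose marginals $v_i(t+1)-v_i(t)$ are nonincreasing in $t$. A partition $(S_i)_{i\in K}$ of $N$ into $k$ parts (no idle workers) is almost balanced if $|w(S_i)-w(S_{i'})|\le 1$ for all $i,i'\in K$, where $w(S)=\sum_{j\in S}w_j$. A policy $\mathbf x_i$ is proportional if $x_{ij}w_{j'}=x_{ij'}w_j$ for all $j,j'\in N$, i.e. $\mathbf x_i=\delta_i\mathbf w$ for some $\delta_i\in\mathbb R$; a PSPE is proportional if all firms' policies are. *)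

theory Defs
  imports Complex_Main "HOL-Library.FuncSet" "HOL-Library.Disjoint_Sets"
begin

section \<open>Competition games\<close>

locale competition_game =
  fixes N :: "'w set" and K :: "'f set" and v :: "'f \<Rightarrow> 'w set \<Rightarrow> real"
  assumes finite_workers: "finite N"
    and finite_firms: "finite K"
    and two_firms: "2 \<le> card K"
    and value_empty: "\<And>i. i \<in> K \<Longrightarrow> v i {} = 0"
    and value_nonneg: "\<And>i S. i \<in> K \<Longrightarrow> S \<subseteq> N \<Longrightarrow> 0 \<le> v i S"
    and value_mono: "\<And>i S T. i \<in> K \<Longrightarrow> S \<subseteq> T \<Longrightarrow> T \<subseteq> N \<Longrightarrow> v i S \<le> v i T"

text \<open>
  Policies, policy profiles and partitions are extensional functions, so that they are determined by
  their values on \<^term>\<open>N\<close>, on \<^term>\<open>K\<close> and on the set of choices below; in particular a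
  tie-breaking rule cannot depend on values outside of the game.
\<close>

definition policies :: "'w set \<Rightarrow> ('w \<Rightarrow> real) set" where
  "policies N = (N \<rightarrow>\<^sub>E UNIV)"

definition policy_profiles :: "'w set \<Rightarrow> 'f set \<Rightarrow> ('f \<Rightarrow> 'w \<Rightarrow> real) set" where
  "policy_profiles N K = (K \<rightarrow>\<^sub>E policies N)"

text \<open>The index set \<open>K \<union> {0}\<close>: \<^term>\<open>None\<close> is the option of staying idle.\<close>

definition choices :: "'f set \<Rightarrow> 'f option set" where
  "choices K = insert None (Some ` K)"

fun payment :: "('f \<Rightarrow> 'w \<Rightarrow> real) \<Rightarrow> 'f option \<Rightarrow> 'w \<Rightarrow> real" where
  "payment X None j = 0"
| "payment X (Some i) j = X i j"

text \<open>Unlike in \<^const>\<open>partition_on\<close>, parts are indexed and may be empty.\<close>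

definition indexed_partition :: "'i set \<Rightarrow> 'w set \<Rightarrow> ('i \<Rightarrow> 'w set) \<Rightarrow> bool" where
  "indexed_partition I N S \<longleftrightarrow> disjoint_family_on S I \<and> (\<Union>i\<in>I. S i) = N"

definition worker_partitions :: "'w set \<Rightarrow> 'f set \<Rightarrow> ('f option \<Rightarrow> 'w set) set" where
  "worker_partitions N K = {P \<in> choices K \<rightarrow>\<^sub>E Pow N. indexed_partition (choices K) N P}"

definition profit ::
    "('f \<Rightarrow> 'w set \<Rightarrow> real) \<Rightarrow> 'f \<Rightarrow> ('f option \<Rightarrow> 'w set) \<Rightarrow> ('f \<Rightarrow> 'w \<Rightarrow> real) \<Rightarrow> real" where
  "profit v i P X = v i (P (Some i)) - (\<Sum>j\<in>P (Some i). X i j)"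

definition optimal_partitions ::
    "'w set \<Rightarrow> 'f set \<Rightarrow> ('f \<Rightarrow> 'w \<Rightarrow> real) \<Rightarrow> ('f option \<Rightarrow> 'w set) set" where
  "optimal_partitions N K X =
     {P \<in> worker_partitions N K.
        \<forall>c\<in>choices K. \<forall>j\<in>P c. payment X c j = Max ((\<lambda>c'. payment X c' j) ` choices K)}"

definition tie_breaking_rule ::
    "'w set \<Rightarrow> 'f set \<Rightarrow> (('f \<Rightarrow> 'w \<Rightarrow> real) \<Rightarrow> ('f option \<Rightarrow> 'w set)) \<Rightarrow> bool" where
  "tie_breaking_rule N K \<tau> \<longleftrightarrow> (\<forall>X\<in>policy_profiles N K. \<tau> X \<in> optimal_partitions N K X)"

definition PSPE ::
    "'w set \<Rightarrow> 'f set \<Rightarrow> ('f \<Rightarrow> 'w set \<Rightarrow> real)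
      \<Rightarrow> ('f option \<Rightarrow> 'w set) \<Rightarrow> ('f \<Rightarrow> 'w \<Rightarrow> real) \<Rightarrow> bool" where
  "PSPE N K v P X \<longleftrightarrow>
     P \<in> worker_partitions N K \<and> X \<in> policy_profiles N K \<and>
     (\<exists>\<tau>. tie_breaking_rule N K \<tau> \<and> P = \<tau> X \<and>
        (\<forall>i\<in>K. \<forall>x\<in>policies N. profit v i (\<tau> (X(i := x))) (X(i := x)) \<le> profit v i P X))"

section \<open>Weighted games\<close>

definition total_weight :: "('w \<Rightarrow> nat) \<Rightarrow> 'w set \<Rightarrow> nat" where
  "total_weight w S = (\<Sum>j\<in>S. w j)"

definition weighted_value :: "('w \<Rightarrow> nat) \<Rightarrow> ('f \<Rightarrow> nat \<Rightarrow> real) \<Rightarrow> 'f \<Rightarrow> 'w set \<Rightarrow> real" where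
  "weighted_value w u i S = u i (total_weight w S)"

locale weighted_competition_game =
  fixes N :: "'w set" and K :: "'f set" and w :: "'w \<Rightarrow> nat" and u :: "'f \<Rightarrow> nat \<Rightarrow> real"
  assumes finite_workers: "finite N"
    and finite_firms: "finite K"
    and two_firms: "2 \<le> card K"
    and weight_pos: "\<And>j. j \<in> N \<Longrightarrow> 0 < w j"
    and value_zero: "\<And>i. i \<in> K \<Longrightarrow> u i 0 = 0"
    and value_nonneg: "\<And>i t. i \<in> K \<Longrightarrow> 0 \<le> u i t"
    and value_mono: "\<And>i. i \<in> K \<Longrightarrow> mono (u i)"
    and marginals_antimono: "\<And>i. i \<in> K \<Longrightarrow> antimono (\<lambda>t. u i (Suc t) - u i t)"

sublocale weighted_competition_game \<subseteq> competition_game N K "weighted_value w u"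
proof
  fix i S T assume "i \<in> K" "S \<subseteq> T" "T \<subseteq> N"
  moreover from this have "total_weight w S \<le> total_weight w T"
    unfolding total_weight_def
    by (intro sum_mono2) (auto intro: finite_subset[OF _ finite_workers])
  ultimately show "weighted_value w u i S \<le> weighted_value w u i T"
    by (simp add: weighted_value_def monoD[OF value_mono])
qed (simp_all add: finite_workers finite_firms two_firms weighted_value_def total_weight_def
      value_zero value_nonneg)

definition almost_balanced_partition ::
    "'w set \<Rightarrow> 'f set \<Rightarrow> ('w \<Rightarrow> nat) \<Rightarrow> ('f \<Rightarrow> 'w set) \<Rightarrow> bool" where
  "almost_balanced_partition N K w S \<longleftrightarrow>
     indexed_partition K N S \<and>
     (\<forall>i\<in>K. \<forall>i'\<in>K. \<bar>int (total_weight w (S i)) - int (total_weight w (S i'))\<bar> \<le> 1)"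

definition proportional_policy :: "'w set \<Rightarrow> ('w \<Rightarrow> nat) \<Rightarrow> ('w \<Rightarrow> real) \<Rightarrow> bool" where
  "proportional_policy N w x \<longleftrightarrow> (\<forall>j\<in>N. \<forall>j'\<in>N. x j * real (w j') = x j' * real (w j))"

definition proportional_PSPE ::
    "'w set \<Rightarrow> 'f set \<Rightarrow> ('w \<Rightarrow> nat) \<Rightarrow> ('f \<Rightarrow> nat \<Rightarrow> real)
      \<Rightarrow> ('f option \<Rightarrow> 'w set) \<Rightarrow> ('f \<Rightarrow> 'w \<Rightarrow> real) \<Rightarrow> bool" where
  "proportional_PSPE N K w u P X \<longleftrightarrow>
     PSPE N K (weighted_value w u) P X \<and> (\<forall>i\<in>K. proportional_policy N w (X i))"

end

theory Submission
  imports Defs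
begin

text \<open>
  (a) Let \<open>q\<close> be the smallest weight of a part of the almost-balanced partition, so every part has
  weight \<open>q\<close> or \<open>q + 1\<close>, and let all firms pay \<open>\<delta> = v (q + 1) - v q\<close> per unit of weight. By concavity
  \<open>v t - \<delta> t\<close> is maximal both at \<open>t = q\<close> and at \<open>t = q + 1\<close>. A deviating firm still faces a competitor
  paying \<open>\<delta>\<close> per unit, so it cannot hire anybody for less, whatever the tie-breaking rule.

  (b) The best payments of a PSPE are Walrasian prices: a firm can hire any set \<open>T\<close> of workers by
  offering slightly more than the best payment to the members of \<open>T\<close> and a negative payment to the
  others. Hence the total value of a PSPE is at least that of every fractional allocation. Take workers
  of weights 2, 2, 3 and firms with values \<open>4 min t 4\<close>, \<open>3 min t 2\<close>, \<open>2 min t 3\<close>. Averaging the sets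
  \<open>{0,1}\<close> and \<open>{2}\<close> for the first firm, \<open>{0}\<close> and \<open>{1}\<close> for the second, and \<open>{}\<close> and \<open>{2}\<close> for the
  third gives total value 23, whereas no partition exceeds 22.
\<close>

section \<open>Payments, optimal partitions and tie-breaking\<close>

text \<open>In an optimal partition this is what worker \<open>j\<close> receives, so it acts as the
  price of \<open>j\<close>.\<close>

definition best_payment :: "'f set \<Rightarrow> ('f \<Rightarrow> 'w \<Rightarrow> real) \<Rightarrow> 'w \<Rightarrow> real" where
  "best_payment K X j = Max ((\<lambda>c. payment X c j) ` choices K)"

lemma finite_choices: "finite K \<Longrightarrow> finite (choices K)"
  by (simp add: choices_def)

lemma choices_simps [simp]: "None \<in> choices K" "Some i \<in> choices K \<longleftrightarrow> i \<in> K"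
  by (auto simp: choices_def)

lemma payment_le_best_payment: "finite K \<Longrightarrow> c \<in> choices K \<Longrightarrow> payment X c j \<le> best_payment K X j"
  unfolding best_payment_def by (intro Max_ge) (auto simp: finite_choices)

lemma best_payment_nonneg: "finite K \<Longrightarrow> 0 \<le> best_payment K X j"
  using payment_le_best_payment[of K None X j] by simp

lemma mem_optimal_partitions_iff:
  "P \<in> optimal_partitions N K X \<longleftrightarrow> P \<in> worker_partitions N K \<and>
     (\<forall>c\<in>choices K. \<forall>j\<in>P c. payment X c j = best_payment K X j)"
  by (simp add: optimal_partitions_def best_payment_def)

lemma worker_partitions_subset:
  "P \<in> worker_partitions N K \<Longrightarrow> c \<in> choices K \<Longrightarrow> P c \<subseteq> N"
  by (auto simp: worker_partitions_def PiE_iff)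

lemma worker_partitions_covers:
  assumes "P \<in> worker_partitions N K" "j \<in> N"
  obtains c where "c \<in> choices K" "j \<in> P c"
  using assms by (auto simp: worker_partitions_def indexed_partition_def)

lemma sum_worker_partition:
  fixes f :: "'w \<Rightarrow> 'a::comm_monoid_add"
  assumes "finite N" "finite K" and P: "P \<in> worker_partitions N K"
  shows "sum f (P None) + (\<Sum>i\<in>K. sum f (P (Some i))) = sum f N"
proof -
  have "(\<Union>c\<in>choices K. P c) = N" "disjoint_family_on P (choices K)"
    using P by (auto simp: worker_partitions_def indexed_partition_def)
  moreover have "finite (P c)" if "c \<in> choices K" for c
    using worker_partitions_subset[OF P that] \<open>finite N\<close> finite_subset by blast
  ultimately have "sum f N = (\<Sum>c\<in>choices K. sum f (P c))"
    using sum.UNION_disjoint[of "choices K" P f] \<open>finite K\<close>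
    by (auto simp: finite_choices disjoint_family_on_def)
  also have "\<dots> = sum f (P None) + (\<Sum>i\<in>K. sum f (P (Some i)))"
    using \<open>finite K\<close> by (subst choices_def) (simp add: sum.reindex)
  finally show ?thesis by simp
qed

text \<open>Each worker can pick a maximizing option independently of the others. Hence tie-breaking
  rules exist.\<close>

lemma optimal_partitions_nonempty:
  assumes "finite K"
  shows "optimal_partitions N K X \<noteq> {}"
proof -
  have "\<exists>c\<in>choices K. payment X c j = best_payment K X j" for j
  proof -
    have "best_payment K X j \<in> (\<lambda>c. payment X c j) ` choices K"
      unfolding best_payment_def
      by (intro Max_in) (use assms in \<open>auto simp: finite_choices choices_def\<close>)
    then show ?thesis by auto
  qed
  then obtain c where c: "\<And>j. c j \<in> choices K" "\<And>j. payment X (c j) j = best_payment K X j"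
    by metis
  have "restrict (\<lambda>d. {j \<in> N. c j = d}) (choices K) \<in> optimal_partitions N K X"
    using c by (auto simp: mem_optimal_partitions_iff worker_partitions_def
        indexed_partition_def disjoint_family_on_def)
  then show ?thesis by blast
qed

lemma policy_profiles_update:
  "X \<in> policy_profiles N K \<Longrightarrow> i \<in> K \<Longrightarrow> x \<in> policies N \<Longrightarrow> X(i := x) \<in> policy_profiles N K"
  by (auto simp: policy_profiles_def PiE_iff extensional_def)

text \<open>If deviations are unprofitable under every optimal partition, ties after a deviation may
  be broken arbitrarily; the rule has to be fixed only at \<open>X\<close>, where it returns
  \<open>P\<close>.\<close>

lemma PSPE_I:
  assumes "finite K" and X: "X \<in> policy_profiles N K" and P: "P \<in> optimal_partitions N K X"
    and dev: "\<And>i x P'. i \<in> K \<Longrightarrow> x \<in> policies N \<Longrightarrow> P' \<in> optimal_partitions N K (X(i := x))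
      \<Longrightarrow> profit v i P' (X(i := x)) \<le> profit v i P X"
  shows "PSPE N K v P X"
proof -
  define \<tau> where "\<tau> Y = (if Y = X then P else SOME Q. Q \<in> optimal_partitions N K Y)" for Y
  have \<tau>: "\<tau> Y \<in> optimal_partitions N K Y" for Y
    using P some_in_eq[of "optimal_partitions N K Y"] optimal_partitions_nonempty[OF \<open>finite K\<close>]
    by (auto simp: \<tau>_def)
  have "P = \<tau> X" by (simp add: \<tau>_def)
  with \<tau> P X dev show ?thesis
    unfolding PSPE_def tie_breaking_rule_def mem_optimal_partitions_iff by metis
qed

section \<open>Prices in an equilibrium\<close>

lemma PSPE_optimal:
  assumes "PSPE N K v P X"
  shows "P \<in> optimal_partitions N K X"
  using assms by (auto simp: PSPE_def tie_breaking_rule_def)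

text \<open>Every worker, idle or hired, receives the best payment, which is 0 for the idle ones; so
  the wages paid add up to the sum of all prices.\<close>

lemma sum_profit:
  assumes "finite N" "finite K" "P \<in> optimal_partitions N K X"
  shows "(\<Sum>i\<in>K. profit v i P X) = (\<Sum>i\<in>K. v i (P (Some i))) - (\<Sum>j\<in>N. best_payment K X j)"
proof -
  have pay: "payment X c j = best_payment K X j" if "c \<in> choices K" "j \<in> P c" for c j
    using assms that by (simp add: mem_optimal_partitions_iff)
  have "(\<Sum>j\<in>N. best_payment K X j)
      = (\<Sum>j\<in>P None. best_payment K X j) + (\<Sum>i\<in>K. \<Sum>j\<in>P (Some i). best_payment K X j)"
    using assms by (simp add: sum_worker_partition mem_optimal_partitions_iff)
  also have "(\<Sum>j\<in>P None. best_payment K X j) = 0"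
    using pay[of None] by (intro sum.neutral) auto
  also have "(\<Sum>i\<in>K. \<Sum>j\<in>P (Some i). best_payment K X j) = (\<Sum>i\<in>K. \<Sum>j\<in>P (Some i). X i j)"
    using pay[of "Some _"] by (intro sum.cong refl) auto
  finally show ?thesis by (simp add: profit_def sum_subtractf)
qed

lemma PSPE_profit_ge:
  assumes "finite N" "finite K" and E: "PSPE N K v P X" and "i \<in> K" "T \<subseteq> N"
  shows "v i T - (\<Sum>j\<in>T. best_payment K X j) \<le> profit v i P X"
proof (rule field_le_epsilon)
  fix e :: real assume "0 < e"
  \<comment> \<open>The surcharge makes the preference for firm \<open>i\<close> strict, so no tie
    can be broken against it. Over all of \<open>T\<close> it costs at most \<open>e\<close>; the 1
    covers empty \<open>T\<close>.\<close>
  define d where "d = e / (1 + card T)"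
  have "0 < d" using \<open>0 < e\<close> by (simp add: d_def)
  \<comment> \<open>An offer of -1 is worse than staying idle, which pays 0.\<close>
  define x where "x = restrict (\<lambda>j. if j \<in> T then best_payment K X j + d else - 1) N"
  have x: "x \<in> policies N" by (simp add: x_def policies_def)
  obtain \<tau> where \<tau>: "tie_breaking_rule N K \<tau>"
    and dev: "\<forall>i\<in>K. \<forall>x\<in>policies N. profit v i (\<tau> (X(i := x))) (X(i := x)) \<le> profit v i P X"
    using E by (auto simp: PSPE_def)
  define Y where "Y = X(i := x)"
  define Q where "Q = \<tau> Y"
  have Q: "Q \<in> optimal_partitions N K Y"
    using E \<tau> policy_profiles_update[OF _ \<open>i \<in> K\<close> x]
    by (auto simp: PSPE_def tie_breaking_rule_def Q_def Y_def)
  then have Qw: "Q \<in> worker_partitions N K"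
    and pay: "\<And>c j. c \<in> choices K \<Longrightarrow> j \<in> Q c \<Longrightarrow> payment Y c j = best_payment K Y j"
    by (auto simp: mem_optimal_partitions_iff)
  have "Q (Some i) = T"
  proof
    show "Q (Some i) \<subseteq> T"
    proof
      fix j assume j: "j \<in> Q (Some i)"
      then have "j \<in> N" using worker_partitions_subset[OF Qw, of "Some i"] \<open>i \<in> K\<close> by auto
      have "0 \<le> x j"
        using pay[of "Some i" j] j \<open>i \<in> K\<close> best_payment_nonneg[OF \<open>finite K\<close>, of Y j]
        by (simp add: Y_def)
      then show "j \<in> T" using \<open>j \<in> N\<close> by (auto simp: x_def split: if_splits)
    qed
    show "T \<subseteq> Q (Some i)"
    proof
      fix j assume j: "j \<in> T"
      then have "j \<in> N" using \<open>T \<subseteq> N\<close> by blast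
      then obtain c where c: "c \<in> choices K" "j \<in> Q c"
        using worker_partitions_covers[OF Qw] by blast
      have "payment X c j < payment Y (Some i) j"
        using payment_le_best_payment[OF \<open>finite K\<close> c(1), of X j] j \<open>j \<in> N\<close> \<open>0 < d\<close>
        by (simp add: Y_def x_def)
      also have "\<dots> \<le> payment Y c j"
        using payment_le_best_payment[OF \<open>finite K\<close>, of "Some i" Y j] \<open>i \<in> K\<close> pay[OF c] by simp
      \<comment> \<open>The payment of option \<open>c\<close> to \<open>j\<close> has risen from
        \<open>X\<close> to \<open>Y\<close>, but only the policy of firm \<open>i\<close> has
        changed.\<close>
      finally have "c = Some i" by (cases c) (auto simp: Y_def split: if_splits)
      with c show "j \<in> Q (Some i)" by simp
    qed
  qed
  then have "profit v i Q Y = v i T - (\<Sum>j\<in>T. best_payment K X j) - card T * d"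
    using \<open>T \<subseteq> N\<close> by (simp add: profit_def Y_def x_def subset_iff sum.distrib)
  moreover have "profit v i Q Y \<le> profit v i P X"
    using dev \<open>i \<in> K\<close> x by (simp add: Q_def Y_def)
  moreover have "card T * d \<le> e"
    using \<open>0 < e\<close> by (simp add: d_def field_simps)
  ultimately show "v i T - (\<Sum>j\<in>T. best_payment K X j) \<le> profit v i P X + e" by linarith
qed

section \<open>Symmetric firms\<close>

text \<open>The marginals are at most the one at \<open>q\<close> to the right of \<open>q\<close>
  and at least it to the left; induction moves away from \<open>q\<close> in each direction.\<close>

lemma concave_seq_le_tangent:
  fixes v :: "nat \<Rightarrow> real"
  assumes "antimono (\<lambda>t. v (Suc t) - v t)"
  shows "v t - (v (Suc q) - v q) * t \<le> v q - (v (Suc q) - v q) * q"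
proof (cases "q \<le> t")
  case True
  then show ?thesis
  proof (induction t rule: dec_induct)
    case (step n)
    then show ?case using antimonoD[OF assms, of q n] by (simp add: algebra_simps)
  qed simp
next
  case False
  then have "t \<le> q" by simp
  then show ?thesis
  proof (induction t rule: inc_induct)
    case (step n)
    then show ?case using antimonoD[OF assms, of n q] by (simp add: algebra_simps)
  qed simp
qed

text \<open>The minimal weight serves as \<open>q\<close>: every other weight exceeds it by at most
  1.\<close>

lemma almost_balanced_weights:
  assumes "finite K" "K \<noteq> {}" "almost_balanced_partition N K w S"
  obtains q where "\<And>i. i \<in> K \<Longrightarrow> total_weight w (S i) \<in> {q, Suc q}"
proof
  define q where "q = Min ((\<lambda>i. total_weight w (S i)) ` K)"
  fix i assume i: "i \<in> K"
  have "q \<in> (\<lambda>i. total_weight w (S i)) ` K" unfolding q_def using assms by (intro Min_in) auto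
  then obtain i' where i': "i' \<in> K" "q = total_weight w (S i')" by blast
  have "q \<le> total_weight w (S i)" unfolding q_def using assms i by (intro Min_le) auto
  moreover have "\<bar>int (total_weight w (S i)) - int (total_weight w (S i'))\<bar> \<le> 1"
    using assms i i' by (simp add: almost_balanced_partition_def)
  ultimately show "total_weight w (S i) \<in> {q, Suc q}" using i' by auto
qed

lemma symmetric_proportional_PSPE:
  fixes v :: "nat \<Rightarrow> real"
  assumes G: "weighted_competition_game N K w (\<lambda>_. v)" and S: "almost_balanced_partition N K w S"
  shows "\<exists>P X. proportional_PSPE N K w (\<lambda>_. v) P X"
proof -
  interpret weighted_competition_game N K w "\<lambda>_. v" by (rule G)
  have "K \<noteq> {}" using two_firms by auto
  then have concave: "antimono (\<lambda>t. v (Suc t) - v t)" and "mono v"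
    using marginals_antimono value_mono by blast+
  obtain q where q: "\<And>i. i \<in> K \<Longrightarrow> total_weight w (S i) \<in> {q, Suc q}"
    using almost_balanced_weights[OF finite_firms \<open>K \<noteq> {}\<close> S] by blast
  define \<delta> where "\<delta> = v (Suc q) - v q"
  \<comment> \<open>The sign makes working at rate \<delta> at least as good as staying
    idle.\<close>
  have "0 \<le> \<delta>" using monoD[OF \<open>mono v\<close>, of q "Suc q"] by (simp add: \<delta>_def)
  define X where "X = restrict (\<lambda>i. restrict (\<lambda>j. \<delta> * w j) N) K"
  define P where "P = restrict (case_option {} S) (choices K)"
  have X: "X \<in> policy_profiles N K"
    by (auto simp: X_def policy_profiles_def policies_def)
  have S_part: "disjoint_family_on S K" "(\<Union>i\<in>K. S i) = N"
    using S by (auto simp: almost_balanced_partition_def indexed_partition_def)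
  have Pw: "P \<in> worker_partitions N K"
    using S_part by (auto simp: P_def worker_partitions_def indexed_partition_def
        disjoint_family_on_def choices_def)
  have best_X: "best_payment K X j = \<delta> * w j" if "j \<in> N" for j
  proof (rule antisym)
    show "best_payment K X j \<le> \<delta> * w j"
      unfolding best_payment_def using that finite_choices[OF finite_firms] \<open>0 \<le> \<delta>\<close>
      by (subst Max_le_iff) (auto simp: choices_def X_def)
    obtain i where "i \<in> K" using \<open>K \<noteq> {}\<close> by blast
    then show "\<delta> * w j \<le> best_payment K X j"
      using payment_le_best_payment[OF finite_firms, of "Some i" X j] that by (simp add: X_def)
  qed
  have P: "P \<in> optimal_partitions N K X"
    unfolding mem_optimal_partitions_iff
  proof (intro conjI ballI Pw)
    fix c j assume c: "c \<in> choices K" and j: "j \<in> P c"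
    then obtain i where "c = Some i" "i \<in> K" by (cases c) (auto simp: P_def)
    moreover have "j \<in> N" using worker_partitions_subset[OF Pw c] j by blast
    ultimately show "payment X c j = best_payment K X j" by (simp add: best_X) (simp add: X_def)
  qed
  have profit_P: "profit (weighted_value w (\<lambda>_. v)) i P X = v q - \<delta> * q" if "i \<in> K" for i
  proof -
    have "S i \<subseteq> N" using S_part that by blast
    then have "(\<Sum>j\<in>S i. X i j) = \<delta> * total_weight w (S i)"
      using that by (simp add: X_def subset_iff total_weight_def sum_distrib_left)
    then have "profit (weighted_value w (\<lambda>_. v)) i P X
        = v (total_weight w (S i)) - \<delta> * total_weight w (S i)"
      using that by (simp add: profit_def weighted_value_def P_def)
    \<comment> \<open>The extra unit of weight in a part of weight \<open>Suc q\<close> adds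
      \<delta> to the value and costs \<delta>.\<close>
    then show ?thesis using q[OF that] by (auto simp: \<delta>_def algebra_simps)
  qed
  have "PSPE N K (weighted_value w (\<lambda>_. v)) P X"
  proof (rule PSPE_I[OF finite_firms X P])
    fix i x P' assume i: "i \<in> K" and P': "P' \<in> optimal_partitions N K (X(i := x))"
    let ?Y = "X(i := x)" and ?T = "P' (Some i)"
    have "?T \<subseteq> N"
      using P' i worker_partitions_subset[of P' N K "Some i"] by (simp add: mem_optimal_partitions_iff)
    \<comment> \<open>A second firm keeps offering \<delta> per unit of weight, which bounds from
      below what the deviator pays to anyone it hires.\<close>
    have "\<not> K \<subseteq> {i}"
      using two_firms card_mono[of "{i}" K] by auto
    then obtain i' where i': "i' \<in> K" "i' \<noteq> i" by blast
    have "\<delta> * w j \<le> ?Y i j" if "j \<in> ?T" for j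
    proof -
      have "?Y i j = best_payment K ?Y j"
        using P' i that by (force simp: mem_optimal_partitions_iff)
      moreover have "payment ?Y (Some i') j = \<delta> * w j"
        using i' that \<open>?T \<subseteq> N\<close> by (auto simp: X_def)
      ultimately show ?thesis
        using payment_le_best_payment[OF finite_firms, of "Some i'" ?Y j] i' by simp
    qed
    then have "\<delta> * total_weight w ?T \<le> (\<Sum>j\<in>?T. ?Y i j)"
      by (simp only: total_weight_def of_nat_sum sum_distrib_left) (rule sum_mono)
    then have "profit (weighted_value w (\<lambda>_. v)) i P' ?Y
        \<le> v (total_weight w ?T) - \<delta> * total_weight w ?T"
      by (simp add: profit_def weighted_value_def)
    also have "\<dots> \<le> v q - \<delta> * q"
      using concave_seq_le_tangent[OF concave] by (simp add: \<delta>_def)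
    finally show "profit (weighted_value w (\<lambda>_. v)) i P' ?Y
        \<le> profit (weighted_value w (\<lambda>_. v)) i P X"
      by (simp add: profit_P[OF i])
  qed
  moreover have "proportional_policy N w (X i)" if "i \<in> K" for i
    using that by (simp add: proportional_policy_def X_def)
  ultimately show ?thesis unfolding proportional_PSPE_def by blast
qed

section \<open>Asymmetric firms\<close>

definition ex_weight :: "nat \<Rightarrow> nat" where
  "ex_weight j = (if j = 2 then 3 else 2)"

definition ex_slope :: "nat \<Rightarrow> nat" where
  "ex_slope i = (if i = 0 then 4 else if i = 1 then 3 else 2)"

definition ex_cap :: "nat \<Rightarrow> nat" where
  "ex_cap i = (if i = 0 then 4 else if i = 1 then 2 else 3)"

definition ex_value :: "nat \<Rightarrow> nat \<Rightarrow> real" where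
  "ex_value i t = real (ex_slope i * min t (ex_cap i))"

lemma ex_game: "weighted_competition_game {0, 1, 2} {0, 1, 2} ex_weight ex_value"
proof
  show "mono (ex_value i)" for i
    by (intro monoI) (auto simp: ex_value_def min_def simp del: of_nat_mult)
  have "ex_value i (Suc t) - ex_value i t = (if t < ex_cap i then ex_slope i else 0)" for i t
    by (auto simp: ex_value_def min_def not_less le_Suc_eq algebra_simps)
  then show "antimono (\<lambda>t. ex_value i (Suc t) - ex_value i t)" for i
    by (auto intro!: antimonoI)
qed (auto simp: ex_weight_def ex_value_def)

lemma ex_almost_balanced:
  "almost_balanced_partition {0, 1, 2} {0, 1, 2} ex_weight (\<lambda>i. {i})"
  by (auto simp: almost_balanced_partition_def indexed_partition_def disjoint_family_on_def
      total_weight_def ex_weight_def)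

text \<open>All weights are at least 2, so no part has weight 1. This integrality is what lowers the
  bound: part weights 4, 2, 1 would give 24. With 1 excluded and total weight at most 7, splitting
  the minima leaves linear arithmetic.\<close>

lemma ex_total_value_le:
  assumes P: "P \<in> worker_partitions {0, 1, 2} {0, 1, 2 :: nat}"
  shows "(\<Sum>i\<in>{0, 1, 2}. weighted_value ex_weight ex_value i (P (Some i))) \<le> 22"
proof -
  define t where "t i = total_weight ex_weight (P (Some i))" for i
  have "t i \<noteq> 1" if "i \<in> {0, 1, 2}" for i
  proof
    assume t: "t i = 1"
    then obtain j where j: "j \<in> P (Some i)" by (fastforce simp: t_def total_weight_def)
    have "finite (P (Some i))"
      using worker_partitions_subset[OF P, of "Some i"] that by (auto intro: finite_subset)
    then have "ex_weight j \<le> t i"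
      unfolding t_def total_weight_def using j by (intro member_le_sum) auto
    then show False using t by (simp add: ex_weight_def split: if_splits)
  qed
  then have "t 0 \<noteq> 1" "t 1 \<noteq> 1" "t 2 \<noteq> 1" by auto
  moreover have "t 0 + t 1 + t 2 \<le> 7"
    using sum_worker_partition[OF _ _ P, of ex_weight]
    by (simp add: t_def total_weight_def ex_weight_def)
  ultimately have "4 * min (t 0) 4 + 3 * min (t 1) 2 + 2 * min (t 2) 3 \<le> 22"
    by (simp add: min_def)
  then have "real (4 * min (t 0) 4 + 3 * min (t 1) 2 + 2 * min (t 2) 3) \<le> 22"
    by linarith
  then show ?thesis
    by (simp add: weighted_value_def ex_value_def ex_slope_def ex_cap_def t_def)
qed

lemma ex_no_PSPE: "\<not> PSPE {0, 1, 2} {0, 1, 2} (weighted_value ex_weight ex_value) P X"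
proof
  let ?N = "{0, 1, 2 :: nat}"
  let ?v = "weighted_value ex_weight ex_value"
  assume E: "PSPE ?N ?N ?v P X"
  define p where "p = best_payment ?N X"
  define r where "r i = profit ?v i P X" for i
  have opt: "P \<in> optimal_partitions ?N ?N X" by (rule PSPE_optimal[OF E])
  have *: "?v i T - sum p T \<le> r i" if "i \<in> ?N" "T \<subseteq> ?N" for i T
    unfolding p_def r_def by (rule PSPE_profit_ge[OF _ _ E that]) auto
  note value_simps = weighted_value_def ex_value_def total_weight_def ex_weight_def
    ex_slope_def ex_cap_def
  \<comment> \<open>There are two bounds per firm, and each price occurs in exactly two of the six.
    Half of their sum says that the total profit is at least 23 minus the sum of the prices.\<close>
  have "16 - (p 0 + p 1) \<le> r 0" using *[of 0 "{0, 1}"] by (simp add: value_simps)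
  moreover have "12 - p 2 \<le> r 0" using *[of 0 "{2}"] by (simp add: value_simps)
  moreover have "6 - p 0 \<le> r 1" using *[of 1 "{0}"] by (simp add: value_simps)
  moreover have "6 - p 1 \<le> r 1" using *[of 1 "{1}"] by (simp add: value_simps)
  moreover have "0 \<le> r 2" using *[of 2 "{}"] by (simp add: value_simps)
  moreover have "6 - p 2 \<le> r 2" using *[of 2 "{2}"] by (simp add: value_simps)
  moreover have "r 0 + r 1 + r 2 \<le> 22 - (p 0 + p 1 + p 2)"
    using sum_profit[OF _ _ opt, of ?v] ex_total_value_le[of P] opt
    by (simp add: mem_optimal_partitions_iff p_def r_def)
  ultimately show False by linarith
qed

theorem proposition4p5:
  shows
    "(\<forall>(N :: 'w set) (K :: 'f set) (w :: 'w \<Rightarrow> nat) (v :: nat \<Rightarrow> real).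
        weighted_competition_game N K w (\<lambda>_. v) \<longrightarrow>
        (\<exists>S. almost_balanced_partition N K w S) \<longrightarrow>
        (\<exists>P X. proportional_PSPE N K w (\<lambda>_. v) P X))
     \<and>
     (\<exists>(N :: nat set) (K :: nat set) (w :: nat \<Rightarrow> nat) (u :: nat \<Rightarrow> nat \<Rightarrow> real).
        weighted_competition_game N K w u \<and>
        (\<exists>i\<in>K. \<exists>i'\<in>K. \<exists>S\<subseteq>N. weighted_value w u i S \<noteq> weighted_value w u i' S) \<and>
        (\<exists>S. almost_balanced_partition N K w S) \<and>
        \<not> (\<exists>P X. PSPE N K (weighted_value w u) P X))"
proof (rule conjI)
  have "\<exists>i\<in>{0, 1, 2}. \<exists>i'\<in>{0, 1, 2}. \<exists>S\<subseteq>{0, 1, 2}.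
      weighted_value ex_weight ex_value i S \<noteq> weighted_value ex_weight ex_value i' S"
    \<comment> \<open>Worker 0 alone, of weight 2, is worth 8 to firm 0 and 6 to firm 1.\<close>
    by (intro bexI[of _ 0] bexI[of _ 1] exI[of _ "{0}"])
      (simp_all add: weighted_value_def ex_value_def total_weight_def ex_weight_def
        ex_slope_def ex_cap_def)
  then show "\<exists>(N :: nat set) (K :: nat set) (w :: nat \<Rightarrow> nat) (u :: nat \<Rightarrow> nat \<Rightarrow> real).
      weighted_competition_game N K w u \<and>
      (\<exists>i\<in>K. \<exists>i'\<in>K. \<exists>S\<subseteq>N. weighted_value w u i S \<noteq> weighted_value w u i' S) \<and>
      (\<exists>S. almost_balanced_partition N K w S) \<and>
      \<not> (\<exists>P X. PSPE N K (weighted_value w u) P X)"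
    using ex_game ex_almost_balanced ex_no_PSPE by blast
qed (use symmetric_proportional_PSPE in blast)

end
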